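(* Let $\varphi: R\longrightarrow T$ be a $t$-compatible homomorphism of integral domains, $I$ an ideal of $R$, and $J$ an ideal of $T$. Then: (a) $\varphi(\widetilde{I})T\subseteq \widetilde{\varphi(I)T}$. (b) $\widetilde{\varphi^{-1}(J)}\subseteq \varphi^{-1}(\widetilde{J})$. Moreover, if $J$ is $t$-integrally closed, then $\widetilde{\varphi^{-1}(J)}=\varphi^{-1}(J)$. Here the $t$-integral closures of $I$ and $\varphi^{-1}(J)$ are taken in $R$, and those of $\varphi(I)T$ and $J$ are taken in $T$.
   Context: All rings are commutative with identity. For an integral domain $R$ with quotient field $K$ and a nonzero fractional ideal $I$ of $R$, put $I^{-1}:=\{x\in K\mid xI\subseteq R\}$, $I_v:=(I^{-1})^{-1}$, and $I_t:=\bigcup J_v$, where $J$ ranges over the nonzero finitely generated subideals of $I$; for the zero ideal, $0_v=0_t=0$. For an ideal $I$ of $R$, an element $x\in R$ is $t$-integral over $I$ if there is an equation $x^{n}+a_{1}x^{n-1}+\dots+a_{n-1}x+a_{n}=0$ with $n\geq 1$ and $a_{i}\in (I^{i})_{t}$ for all $i=1,\dots,n$. The $t$-integral closure $\widetilde{I}$ of $I$ is the set of all elements of $R$ that are $t$-integral over $I$ (so the $t$-integral closure of the zero ideal is zero); $I$ is $t$-integrally closed if $\widetilde{I}=I$. Denote by $t$ and $t_1$ the $t$-closures in $R$ and $T$, respectively. A homomorphism of integral domains $\varphi:R\to T$ is $t$-compatible if $\varphi(I_{t})T\subseteq (\varphi(I)T)_{t_{1}}$ for each nonzero ideal $I$ of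 $R$. *)

theory Defs
  imports "HOL-Computational_Algebra.Polynomial_Factorial"
begin

text \<open>
  A ring is the universe of a type, its ideals are the submodules of the ring over itself, and its
  quotient field \<open>K\<close> is the type \<open>'a fract\<close>, an \<open>R\<close>-module through \<open>to_fract\<close>.
  The module constants are used without a global interpretation, because that would put
  the library rule \<open>scale_scale\<close>, here \<open>a * (b * x) = (a * b) * x\<close>, into the simpset.
\<close>

abbreviation is_ideal :: "'a::comm_ring_1 set \<Rightarrow> bool" where
  "is_ideal \<equiv> module.subspace (*)"

abbreviation ideal_span :: "'a::comm_ring_1 set \<Rightarrow> 'a set" where
  "ideal_span \<equiv> module.span (*)"

abbreviation frac_span :: "'a::idom fract set \<Rightarrow> 'a fract set" where
  "frac_span \<equiv> module.span (\<lambda>(r :: 'a) x. to_fract r * x)"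

lemma module_ring: "module ((*) :: 'a::comm_ring_1 \<Rightarrow> 'a \<Rightarrow> 'a)"
  by unfold_locales (simp_all add: algebra_simps)

lemma module_fract: "module (\<lambda>(r :: 'a::idom) x. to_fract r * x)"
  by unfold_locales (simp_all add: algebra_simps)

locale ring_homomorphism =
  fixes \<phi> :: "'a::comm_ring_1 \<Rightarrow> 'b::comm_ring_1"
  assumes map_one: "\<phi> 1 = 1"
    and map_add: "\<phi> (x + y) = \<phi> x + \<phi> y"
    and map_mult: "\<phi> (x * y) = \<phi> x * \<phi> y"

definition frac_inv :: "'a::idom fract set \<Rightarrow> 'a fract set" where
  "frac_inv I = {x. \<forall>y\<in>I. x * y \<in> range to_fract}"

text \<open>The zero ideal is treated separately: the double inverse of \<open>{0}\<close> is all of \<open>K\<close> when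
  \<open>R = K\<close>, and \<open>{0}\<close> has no nonzero subideals, whereas by convention both closures are zero.\<close>

definition v_closure :: "'a::idom fract set \<Rightarrow> 'a fract set" where
  "v_closure I = (if I = {0} then {0} else frac_inv (frac_inv I))"

definition frac_finitely_generated :: "'a::idom fract set \<Rightarrow> bool" where
  "frac_finitely_generated J \<longleftrightarrow> (\<exists>S. finite S \<and> J = frac_span S)"

definition t_closure :: "'a::idom fract set \<Rightarrow> 'a fract set" where
  "t_closure I = (if I = {0} then {0}
     else \<Union> {v_closure J | J. J \<noteq> {0} \<and> frac_finitely_generated J \<and> J \<subseteq> I})"

text \<open>The \<open>t\<close>-closure of an ideal of \<open>R\<close>, pulled back from \<open>K\<close> to \<open>R\<close>. Nothing is lost, since the
  \<open>t\<close>-closure of an integral ideal lies in \<open>R\<close>; see \<open>to_fract_image_t_ideal\<close> below.\<close>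

definition t_ideal :: "'a::idom set \<Rightarrow> 'a set" where
  "t_ideal I = to_fract -` t_closure (to_fract ` I)"

lemma t_closure_integral:
  assumes "I \<subseteq> range to_fract"
  shows "t_closure I \<subseteq> range to_fract"
proof -
  have "v_closure J \<subseteq> range to_fract" if "J \<noteq> {0}" "J \<subseteq> I" for J
  proof -
    have "1 \<in> frac_inv J"
      using that assms by (auto simp: frac_inv_def)
    then have "x \<in> range to_fract" if "x \<in> frac_inv (frac_inv J)" for x
      using that by (metis (no_types, lifting) frac_inv_def mem_Collect_eq mult.right_neutral)
    then show ?thesis
      using \<open>J \<noteq> {0}\<close> by (auto simp only: v_closure_def if_False)
  qed
  moreover have "(0 :: 'a fract) \<in> range to_fract"
    by (metis rangeI to_fract_0)
  ultimately show ?thesis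
    unfolding t_closure_def by (simp split: if_splits) blast
qed

lemma to_fract_image_t_ideal: "to_fract ` t_ideal I = t_closure (to_fract ` I)"
  using t_closure_integral[of "to_fract ` I"] by (auto simp: t_ideal_def)

definition ideal_mult :: "'a::comm_ring_1 set \<Rightarrow> 'a set \<Rightarrow> 'a set" where
  "ideal_mult I J = ideal_span {a * b | a b. a \<in> I \<and> b \<in> J}"

primrec ideal_power :: "'a::comm_ring_1 set \<Rightarrow> nat \<Rightarrow> 'a set" where
  "ideal_power I 0 = UNIV"
| "ideal_power I (Suc n) = ideal_mult I (ideal_power I n)"

definition t_integral_over :: "'a::idom \<Rightarrow> 'a set \<Rightarrow> bool" where
  "t_integral_over x I \<longleftrightarrow>
     (\<exists>n\<ge>1. \<exists>a :: nat \<Rightarrow> 'a. (\<forall>i\<in>{1..n}. a i \<in> t_ideal (ideal_power I i)) \<and>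
        x ^ n + (\<Sum>i=1..n. a i * x ^ (n - i)) = 0)"

definition t_integral_closure :: "'a::idom set \<Rightarrow> 'a set" where
  "t_integral_closure I = {x. t_integral_over x I}"

definition t_integrally_closed :: "'a::idom set \<Rightarrow> bool" where
  "t_integrally_closed I \<longleftrightarrow> t_integral_closure I = I"

definition t_compatible :: "('a::idom \<Rightarrow> 'b::idom) \<Rightarrow> bool" where
  "t_compatible \<phi> \<longleftrightarrow>
     (\<forall>I. is_ideal I \<and> I \<noteq> {0} \<longrightarrow>
        ideal_span (\<phi> ` t_ideal I) \<subseteq> t_ideal (ideal_span (\<phi> ` I)))"

end

theory Submission
  imports Defs "Jordan_Normal_Form.Char_Poly"
begin

text \<open>
  Since the image of the \<open>t\<close>-integral closure of \<open>I\<close> need not be an ideal, part (a) rests on the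
  \<open>t\<close>-integral closure of an ideal being an ideal. For this, pass to the \<open>t\<close>-Rees algebra
  \<open>\<Oplus>\<^sub>n (I^n)\<^sub>t X^n \<subseteq> R[X]\<close>, which is a ring because \<open>(I^m)\<^sub>t (I^n)\<^sub>t \<subseteq> (I^(m+n))\<^sub>t\<close>: an element \<open>x\<close> is
  \<open>t\<close>-integral over \<open>I\<close> iff \<open>xX\<close> is integral over this algebra, and integral elements over a subring
  are closed under addition. Given this, (a) holds since \<open>t\<close>-compatibility lets \<open>\<phi>\<close> map equations of
  \<open>t\<close>-integral dependence to such equations, and (b) follows by monotonicity from
  \<open>\<phi>(\<phi>\<^sup>-\<^sup>1(J))T \<subseteq> J\<close>.
\<close>

section \<open>Integral elements over a subring\<close>

text \<open>A set rather than a type, so that it can be instantiated inside polynomial rings as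
  well, in particular with the t-Rees algebra.\<close>

locale unital_subring =
  fixes S :: "'a::comm_ring_1 set"
  assumes one_closed: "1 \<in> S"
    and add_closed: "x \<in> S \<Longrightarrow> y \<in> S \<Longrightarrow> x + y \<in> S"
    and uminus_closed: "x \<in> S \<Longrightarrow> - x \<in> S"
    and mult_closed: "x \<in> S \<Longrightarrow> y \<in> S \<Longrightarrow> x * y \<in> S"
begin

lemma zero_closed: "0 \<in> S"
  using add_closed[OF one_closed uminus_closed[OF one_closed]] by simp

lemma sum_closed: "(\<And>x. x \<in> A \<Longrightarrow> f x \<in> S) \<Longrightarrow> sum f A \<in> S"
  by (induction A rule: infinite_finite_induct) (auto intro: zero_closed add_closed)

lemma prod_closed: "(\<And>x. x \<in> A \<Longrightarrow> f x \<in> S) \<Longrightarrow> prod f A \<in> S"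
  by (induction A rule: infinite_finite_induct) (auto intro: one_closed mult_closed)

text \<open>This set is \<open>S[X]\<close>; closure of determinants over it controls the
  coefficients of characteristic polynomials.\<close>

lemma unital_subring_coeffs: "unital_subring {p. \<forall>i. coeff p i \<in> S}"
proof
  show "1 \<in> {p. \<forall>i. coeff p i \<in> S}"
    by (auto simp: coeff_1 zero_closed one_closed)
qed (auto simp: coeff_mult intro: add_closed uminus_closed sum_closed mult_closed)

section \<open>Determinants and characteristic polynomials over a subring\<close>

lemma det_closed:
  assumes "A \<in> carrier_mat n n" "\<And>i j. i < n \<Longrightarrow> j < n \<Longrightarrow> A $$ (i, j) \<in> S"
  shows "det A \<in> S"
  unfolding det_def'[OF assms(1)]
proof (intro sum_closed mult_closed prod_closed)
  show "signof p \<in> S" for p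
    by (simp add: sign_def one_closed uminus_closed)
qed (use assms(2) in \<open>auto dest: permutes_in_image\<close>)

lemma coeff_char_poly_closed:
  assumes "A \<in> carrier_mat n n" "\<And>i j. i < n \<Longrightarrow> j < n \<Longrightarrow> A $$ (i, j) \<in> S"
  shows "coeff (char_poly A) i \<in> S"
proof -
  interpret P: unital_subring "{p. \<forall>i. coeff p i \<in> S}"
    by (rule unital_subring_coeffs)
  \<comment> \<open>The characteristic polynomial is the determinant of a matrix with entries in
    \<open>S[X]\<close>, so \<open>det_closed\<close> is applied to \<open>S[X]\<close> instead of
    \<open>S\<close>.\<close>
  have "char_poly_matrix A $$ (i, j) \<in> {p. \<forall>i. coeff p i \<in> S}" if "i < n" "j < n" for i j
    using assms that
    by (auto simp: char_poly_matrix_def coeff_pCons split: nat.splits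
        intro: zero_closed one_closed uminus_closed)
  then show ?thesis
    using P.det_closed[OF char_poly_matrix_closed[OF assms(1)]] by (auto simp: char_poly_def)
qed

definition integral_over :: "'a \<Rightarrow> bool" where
  "integral_over w \<longleftrightarrow> (\<exists>p. monic p \<and> (\<forall>i. coeff p i \<in> S) \<and> poly p w = 0)"

text \<open>Links the polynomial form, suited to the determinant trick, to the shape of equation in
  \<open>t_integral_over\<close>, where \<open>c i\<close> belongs to the power
  \<open>n - i\<close>. The case \<open>n = 0\<close> is harmless, as the equation then reads
  \<open>1 = 0\<close>.\<close>

lemma integral_over_iff:
  "integral_over w \<longleftrightarrow> (\<exists>n c. (\<forall>i\<in>{1..n}. c i \<in> S) \<and> w ^ n + (\<Sum>i=1..n. c i * w ^ (n - i)) = 0)"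
proof
  assume "integral_over w"
  then obtain p where p: "monic p" "\<And>i. coeff p i \<in> S" "poly p w = 0"
    by (auto simp: integral_over_def)
  define n where "n = degree p"
  have "(\<Sum>i=1..n. coeff p (n - i) * w ^ (n - i)) = (\<Sum>k<n. coeff p k * w ^ k)"
    unfolding One_nat_def sum.atLeast1_atMost_eq by (rule sum.nat_diff_reindex)
  then have "w ^ n + (\<Sum>i=1..n. coeff p (n - i) * w ^ (n - i)) = poly p w"
    using p(1) by (simp add: poly_altdef n_def lessThan_Suc_atMost[symmetric])
  then show "\<exists>n c. (\<forall>i\<in>{1..n}. c i \<in> S) \<and> w ^ n + (\<Sum>i=1..n. c i * w ^ (n - i)) = 0"
    using p by (intro exI[of _ n] exI[of _ "\<lambda>i. coeff p (n - i)"]) simp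
next
  assume "\<exists>n c. (\<forall>i\<in>{1..n}. c i \<in> S) \<and> w ^ n + (\<Sum>i=1..n. c i * w ^ (n - i)) = 0"
  then obtain n c where c: "\<And>i. i \<in> {1..n} \<Longrightarrow> c i \<in> S"
    "w ^ n + (\<Sum>i=1..n. c i * w ^ (n - i)) = 0"
    by blast
  \<comment> \<open>\<open>q\<close> collects the terms of degree below \<open>n\<close>, so that
    \<open>p\<close> is monic of degree exactly \<open>n\<close>.\<close>
  define q where "q = (\<Sum>i=1..n. monom (c i) (n - i))"
  have coeff_q: "coeff q k = (\<Sum>i=1..n. if n - i = k then c i else 0)" for k
    by (simp add: q_def coeff_sum)
  have q: "coeff q k = 0" if "n \<le> k" for k
    unfolding coeff_q using that by (intro sum.neutral) auto
  define p where "p = monom 1 n + q"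
  have coeff_p: "coeff p k = (if k = n then 1 else 0) + coeff q k" for k
    by (simp add: p_def)
  have "degree p = n"
    by (rule antisym) (auto simp: coeff_p q intro!: degree_le le_degree)
  then have "monic p"
    by (simp add: coeff_p q)
  moreover have "coeff p k \<in> S" for k
    using c(1) unfolding coeff_p coeff_q
    by (intro add_closed sum_closed) (auto intro: zero_closed one_closed)
  moreover have "poly p w = 0"
    using c(2) by (simp add: p_def q_def poly_monom poly_sum)
  ultimately show "integral_over w"
    by (auto simp: integral_over_def)
qed

section \<open>Finitely generated modules over the subring\<close>

definition lin_comb :: "'a set \<Rightarrow> 'a set" where
  "lin_comb G = {\<Sum>g\<in>G. s g * g | s. \<forall>g\<in>G. s g \<in> S}"

text \<open>The determinant trick: \<open>w\<close> is an eigenvalue of a matrix over \<open>S\<close>, with the elements of \<open>G\<close>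
  as the entries of an eigenvector, hence a root of the characteristic polynomial.\<close>

lemma integral_over_if_stable:
  assumes "finite G" "1 \<in> G" "\<And>g. g \<in> G \<Longrightarrow> w * g \<in> lin_comb G"
  shows "integral_over w"
proof -
  have "\<forall>g\<in>G. \<exists>s. (\<forall>h\<in>G. s h \<in> S) \<and> w * g = (\<Sum>h\<in>G. s h * h)"
    using assms(3) by (auto simp: lin_comb_def)
  then obtain s where s: "\<And>g h. g \<in> G \<Longrightarrow> h \<in> G \<Longrightarrow> s g h \<in> S"
    "\<And>g. g \<in> G \<Longrightarrow> w * g = (\<Sum>h\<in>G. s g h * h)"
    by metis
  define n where "n = card G"
  obtain e where e: "bij_betw e {0..<n} G"
    unfolding n_def using ex_bij_betw_nat_finite[OF assms(1)] by blast
  then have eG: "e i \<in> G" if "i < n" for i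
    using that by (auto simp: bij_betw_def)
  \<comment> \<open>\<open>C\<close> expresses multiplication by \<open>w\<close> on the generators,
    enumerated by \<open>e\<close>; \<open>M\<close> is \<open>w\<close> times the identity minus
    \<open>C\<close>.\<close>
  define C where "C = mat n n (\<lambda>(i, j). s (e i) (e j))"
  define M where "M = mat n n (\<lambda>(i, j). (if i = j then w else 0) - s (e i) (e j))"
  define v where "v = vec n e"
  have C: "C \<in> carrier_mat n n" and M: "M \<in> carrier_mat n n" and v: "v \<in> carrier_vec n"
    by (auto simp: C_def M_def v_def)
  have "M *\<^sub>v v = 0\<^sub>v n"
  proof (rule eq_vecI)
    fix i assume "i < dim_vec (0\<^sub>v n)"
    then have i: "i < n" by simp
    have "(M *\<^sub>v v) $ i = (\<Sum>j=0..<n. ((if i = j then w else 0) - s (e i) (e j)) * e j)"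
      using i by (simp add: M_def v_def scalar_prod_def)
    also have "\<dots> = (\<Sum>j=0..<n. if i = j then w * e j else 0) - (\<Sum>j=0..<n. s (e i) (e j) * e j)"
      unfolding sum_subtractf[symmetric] by (intro sum.cong) (auto simp: left_diff_distrib)
    also have "(\<Sum>j=0..<n. s (e i) (e j) * e j) = w * e i"
      unfolding s(2)[OF eG[OF i]] by (rule sum.reindex_bij_betw[OF e])
    finally show "(M *\<^sub>v v) $ i = 0\<^sub>v n $ i"
      using i by simp
  qed (use M in auto)
  \<comment> \<open>The adjugate turns \<open>M v = 0\<close> into \<open>det M\<close> times
    \<open>v\<close> being zero, with no division needed.\<close>
  moreover have "adj_mat M *\<^sub>v (M *\<^sub>v v) = det M \<cdot>\<^sub>v v"
    unfolding assoc_mult_mat_vec[OF adj_mat(1)[OF M] M v, symmetric] adj_mat(3)[OF M]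
    using v by (auto intro!: eq_vecI simp: scalar_prod_def if_distrib[of "\<lambda>c. c * _"]
        if_distrib[of "(*) (det M)"] cong: if_cong)
  moreover have "adj_mat M *\<^sub>v 0\<^sub>v n = 0\<^sub>v n"
    using adj_mat(1)[OF M] by (auto intro!: eq_vecI simp: scalar_prod_def)
  ultimately have 0: "det M \<cdot>\<^sub>v v = 0\<^sub>v n"
    by simp
  \<comment> \<open>Since 1 is an entry of \<open>v\<close>, that entry alone forces
    \<open>det M = 0\<close>.\<close>
  obtain k where "k < n" "e k = 1"
    using e assms(2) by (auto simp: bij_betw_def image_iff)
  then have "det M = 0"
    using arg_cong[OF 0, of "\<lambda>u. u $ k"] by (simp add: v_def)
  \<comment> \<open>Evaluation at \<open>w\<close> commutes with taking determinants.\<close>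
  moreover have "poly (char_poly C) w = det M"
    unfolding char_poly_def
    by (rule poly_det_cong[OF M]) (auto simp: char_poly_matrix_def C_def M_def)
  moreover have "coeff (char_poly C) i \<in> S" for i
    by (rule coeff_char_poly_closed[OF C]) (auto simp: C_def s(1) eG)
  ultimately show ?thesis
    using degree_monic_char_poly[OF C] by (auto simp: integral_over_def)
qed

lemma lin_comb_base: "finite G \<Longrightarrow> g \<in> G \<Longrightarrow> g \<in> lin_comb G"
  unfolding lin_comb_def
  by (auto intro!: exI[of _ "\<lambda>h. if h = g then 1 else 0"]
      simp: zero_closed one_closed if_distrib[of "\<lambda>c. c * _"] cong: if_cong)

lemma lin_comb_add: "x \<in> lin_comb G \<Longrightarrow> y \<in> lin_comb G \<Longrightarrow> x + y \<in> lin_comb G"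
  unfolding lin_comb_def
  by (auto simp: sum.distrib[symmetric] distrib_right[symmetric] intro!: add_closed)

lemma lin_comb_scale: "c \<in> S \<Longrightarrow> x \<in> lin_comb G \<Longrightarrow> c * x \<in> lin_comb G"
  unfolding lin_comb_def
  by (auto simp: sum_distrib_left mult.assoc[symmetric] intro!: mult_closed)

lemma lin_comb_sum: "(\<And>x. x \<in> A \<Longrightarrow> f x \<in> lin_comb G) \<Longrightarrow> sum f A \<in> lin_comb G"
proof (induction A rule: infinite_finite_induct)
  case empty
  then show ?case by (auto simp: lin_comb_def zero_closed intro!: exI[of _ "\<lambda>_. 0"])
next
  case (infinite A)
  then show ?case by (auto simp: lin_comb_def zero_closed intro!: exI[of _ "\<lambda>_. 0"])
qed (auto intro: lin_comb_add)

text \<open>Only \<open>k = degree p\<close> needs an argument: the monic relation rewrites the top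
  power of \<open>x\<close> by lower ones. The factor \<open>y\<close> carries the powers of the
  second element in \<open>integral_over_add\<close>.\<close>

lemma power_mult_in_lin_comb:
  assumes "monic p" "\<And>i. coeff p i \<in> S" "poly p x = 0" "k \<le> degree p"
    and "\<And>i. i < degree p \<Longrightarrow> x ^ i * y \<in> lin_comb G"
  shows "x ^ k * y \<in> lin_comb G"
proof (cases "k = degree p")
  case True
  have "x ^ degree p = (\<Sum>i<degree p. - coeff p i * x ^ i)"
    using assms(1,3) by (simp add: poly_altdef lessThan_Suc_atMost[symmetric] sum_negf eq_neg_iff_add_eq_0 add.commute)
  then have "x ^ k * y = (\<Sum>i<degree p. - coeff p i * (x ^ i * y))"
    by (simp add: True sum_distrib_right mult.assoc)
  also have "\<dots> \<in> lin_comb G"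
    by (intro lin_comb_sum lin_comb_scale uminus_closed assms) simp
  finally show ?thesis .
qed (use assms in auto)

text \<open>The products \<open>x ^ i * y ^ j\<close> below the two degrees span a module that is
  stable under multiplication by \<open>x\<close> and by \<open>y\<close>, hence by
  \<open>x + y\<close>.\<close>

lemma integral_over_add:
  assumes "integral_over x" "integral_over y"
  shows "integral_over (x + y)"
proof -
  obtain p q where p: "monic p" "\<And>i. coeff p i \<in> S" "poly p x = 0"
    and q: "monic q" "\<And>i. coeff q i \<in> S" "poly q y = 0"
    using assms by (auto simp: integral_over_def)
  show ?thesis
  proof (cases "degree p = 0 \<or> degree q = 0")
    \<comment> \<open>A monic polynomial of degree 0 is 1 and has no root. With this excluded,
      \<open>G\<close> contains 1 as the product with exponents \<open>(0, 0)\<close>.\<close>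
    case True
    then have "p = 1 \<or> q = 1"
      using p(1) q(1) by (metis monic_degree_0)
    then have "(1 :: 'a) = 0"
      using p(3) q(3) by auto
    then show ?thesis
      using p by (metis integral_over_def mult_1 mult_zero_left)
  next
    case False
    define G where "G = (\<lambda>(i, j). x ^ i * y ^ j) ` ({..<degree p} \<times> {..<degree q})"
    have fin: "finite G"
      by (simp add: G_def)
    have base: "x ^ i * y ^ j \<in> lin_comb G" if "i < degree p" "j < degree q" for i j
      by (rule lin_comb_base[OF fin]) (use that in \<open>auto simp: G_def\<close>)
    show ?thesis
    proof (rule integral_over_if_stable[OF fin])
      show "1 \<in> G"
        using False by (force simp: G_def image_iff intro: bexI[of _ "(0, 0)"])
      fix g assume "g \<in> G"
      then obtain i j where ij: "i < degree p" "j < degree q" "g = x ^ i * y ^ j"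
        by (auto simp: G_def)
      have "x ^ Suc i * y ^ j \<in> lin_comb G"
        by (rule power_mult_in_lin_comb[OF p]) (use ij base in auto)
      moreover have "y ^ Suc j * x ^ i \<in> lin_comb G"
        by (rule power_mult_in_lin_comb[OF q]) (use ij base in \<open>auto simp: mult.commute\<close>)
      ultimately have "x ^ Suc i * y ^ j + y ^ Suc j * x ^ i \<in> lin_comb G"
        by (rule lin_comb_add)
      then show "(x + y) * g \<in> lin_comb G"
        by (simp add: ij algebra_simps)
    qed
  qed
qed

end

section \<open>The \<open>t\<close>-closure of ideals\<close>

lemmas ideal_0 = module.subspace_0[OF module_ring]
  and ideal_add = module.subspace_add[OF module_ring]
  and ideal_scale = module.subspace_scale[OF module_ring]
  and ideal_neg = module.subspace_neg[OF module_ring]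
  and idealI = module.subspaceI[OF module_ring]
  and is_ideal_span = module.subspace_span[OF module_ring]
  and ideal_span_base = module.span_base[OF module_ring]
  and ideal_span_minimal = module.span_minimal[OF module_ring]

text \<open>For fixed \<open>x\<close>, the \<open>y\<close> with \<open>x * y\<close> in the ring
  form a submodule of \<open>K\<close>, so it suffices to test generators.\<close>

lemma frac_inv_frac_span: "frac_inv (frac_span S) = frac_inv S"
proof
  show "frac_inv (frac_span S) \<subseteq> frac_inv S"
    using module.span_base[OF module_fract] by (auto simp: frac_inv_def)
  show "frac_inv S \<subseteq> frac_inv (frac_span S)"
  proof
    fix x assume x: "x \<in> frac_inv S"
    have "module.subspace (\<lambda>r. (*) (to_fract r)) {y. x * y \<in> range to_fract}" (is "module.subspace _ ?Y")
    proof (rule module.subspaceI[OF module_fract])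
      show "0 \<in> ?Y"
        by (auto intro: image_eqI[of _ _ 0])
      show "y + z \<in> ?Y" if "y \<in> ?Y" "z \<in> ?Y" for y z
        using that by (auto simp: distrib_left to_fract_add[symmetric] simp del: to_fract_add)
      show "to_fract c * y \<in> ?Y" if "y \<in> ?Y" for c y
        using that by (auto simp: mult.left_commute[of x] to_fract_mult[symmetric] simp del: to_fract_mult)
    qed
    then have "frac_span S \<subseteq> {y. x * y \<in> range to_fract}"
      using x by (intro module.span_minimal[OF module_fract]) (auto simp: frac_inv_def)
    then show "x \<in> frac_inv (frac_span S)"
      by (auto simp: frac_inv_def)
  qed
qed

text \<open>A finite criterion replacing v-closures: \<open>x\<close> lies in the v-closure of the
  ideal generated by \<open>S\<close> iff each \<open>u\<close> in \<open>K\<close> that multiplies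
  \<open>S\<close> into the ring does the same to \<open>x\<close>. The disjunct
  \<open>x = 0\<close> absorbs the convention for the zero ideal.\<close>

lemma mem_t_ideal_iff:
  assumes "is_ideal I"
  shows "x \<in> t_ideal I \<longleftrightarrow> x = 0 \<or>
    (\<exists>S\<subseteq>I. finite S \<and> (\<exists>s\<in>S. s \<noteq> 0) \<and>
      (\<forall>u. (\<forall>s\<in>S. u * to_fract s \<in> range to_fract) \<longrightarrow> u * to_fract x \<in> range to_fract))"
    (is "_ \<longleftrightarrow> _ \<or> (\<exists>S\<subseteq>I. ?P S)")
proof (cases "I = {0}")
  case True
  then show ?thesis
    by (auto simp: t_ideal_def t_closure_def)
next
  case False
  then obtain r where r: "r \<in> I" "r \<noteq> 0"
    using ideal_0[OF assms] by auto
  then have ne: "to_fract ` I \<noteq> {0}"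
    by (metis image_eqI singletonD to_fract_eq_0_iff)
  have eq: "{v_closure J | J. J \<noteq> {0} \<and> frac_finitely_generated J \<and> J \<subseteq> to_fract ` I} =
      {frac_inv (frac_inv J) | J. J \<noteq> {0} \<and> frac_finitely_generated J \<and> J \<subseteq> to_fract ` I}"
    by (intro Collect_cong ex_cong1) (simp only: v_closure_def split: if_split, blast)
  have mem: "x \<in> t_ideal I \<longleftrightarrow> (\<exists>J. J \<noteq> {0} \<and> frac_finitely_generated J \<and> J \<subseteq> to_fract ` I \<and>
      to_fract x \<in> frac_inv (frac_inv J))"
    unfolding t_ideal_def t_closure_def if_not_P[OF ne] eq by blast
  have vv: "to_fract x \<in> frac_inv (frac_inv (frac_span (to_fract ` S))) \<longleftrightarrow>
      (\<forall>u. (\<forall>s\<in>S. u * to_fract s \<in> range to_fract) \<longrightarrow> u * to_fract x \<in> range to_fract)" for S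
    unfolding frac_inv_frac_span by (auto simp: frac_inv_def mult.commute)
  show ?thesis
  proof
    assume "x \<in> t_ideal I"
    then obtain S' where S': "finite S'" "frac_span S' \<noteq> {0}" "frac_span S' \<subseteq> to_fract ` I"
      "to_fract x \<in> frac_inv (frac_inv (frac_span S'))"
      by (auto simp: mem frac_finitely_generated_def)
    \<comment> \<open>The generators lie in the ideal they span, hence in the image of
      \<open>I\<close>, and can be pulled back to a finite subset of \<open>I\<close>.\<close>
    then have "S' \<subseteq> to_fract ` I"
      using module.span_superset[OF module_fract] by blast
    then obtain S where S: "S \<subseteq> I" "finite S" "S' = to_fract ` S"
      using finite_subset_image[OF S'(1)] by metis
    have "\<exists>s\<in>S. s \<noteq> 0"
    proof (rule ccontr)
      assume "\<not> ?thesis"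
      then have "frac_span S' \<subseteq> {0}"
        by (intro module.span_minimal[OF module_fract] module.subspace_single_0[OF module_fract])
          (auto simp: S)
      then show False
        using S'(2) module.span_zero[OF module_fract] by blast
    qed
    then have "?P S"
      using S(2) S'(4) unfolding S(3) vv by simp
    with S(1) show "x = 0 \<or> (\<exists>S\<subseteq>I. ?P S)"
      by (intro disjI2) (rule exI, rule conjI)
  next
    assume x: "x = 0 \<or> (\<exists>S\<subseteq>I. ?P S)"
    obtain S where S: "S \<subseteq> I" "?P S"
    proof (cases "x = 0")
      \<comment> \<open>Here the assumption supplies no set, so a nonzero element \<open>r\<close>
        of \<open>I\<close> is used as the single generator.\<close>
      case True
      then have "?P {r}"
        using r(2) by (auto intro: image_eqI[of _ _ 0])
      then show thesis
        using r(1) by (intro that[of "{r}"]) simp_all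
    next
      case False
      with x obtain S where S: "S \<subseteq> I \<and> ?P S"
        by (elim disjE exE) simp_all
      show thesis
        by (rule that[OF conjunct1[OF S] conjunct2[OF S]])
    qed
    have "module.subspace (\<lambda>r. (*) (to_fract r)) (to_fract ` I)"
    proof (rule module.subspaceI[OF module_fract])
      show "0 \<in> to_fract ` I"
        using ideal_0[OF assms] by (metis image_eqI to_fract_0)
    qed (auto simp: to_fract_add[symmetric] to_fract_mult[symmetric]
        simp del: to_fract_add to_fract_mult intro: ideal_add[OF assms] ideal_scale[OF assms])
    then have "frac_span (to_fract ` S) \<subseteq> to_fract ` I"
      using S(1) by (intro module.span_minimal[OF module_fract]) auto
    moreover have "frac_span (to_fract ` S) \<noteq> {0}"
      using S(2) module.span_base[OF module_fract] by (metis image_eqI singletonD to_fract_eq_0_iff)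
    ultimately show "x \<in> t_ideal I"
      unfolding mem frac_finitely_generated_def
      using S(2) vv[of S] by (intro exI[of _ "frac_span (to_fract ` S)"] conjI exI[of _ "to_fract ` S"]) simp_all
  qed
qed

lemma t_ideal_nonzeroE:
  assumes "is_ideal I" "x \<in> t_ideal I" "x \<noteq> 0"
  obtains S where "S \<subseteq> I" "finite S" "\<exists>s\<in>S. s \<noteq> 0"
    "\<And>u. (\<And>s. s \<in> S \<Longrightarrow> u * to_fract s \<in> range to_fract) \<Longrightarrow> u * to_fract x \<in> range to_fract"
proof -
  obtain S where "S \<subseteq> I" "finite S" "\<exists>s\<in>S. s \<noteq> 0"
    "\<forall>u. (\<forall>s\<in>S. u * to_fract s \<in> range to_fract) \<longrightarrow> u * to_fract x \<in> range to_fract"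
    using assms(2,3) unfolding mem_t_ideal_iff[OF assms(1)] by auto
  then show thesis
    by (intro that[of S]) simp_all
qed

lemma t_ideal_superset:
  assumes "is_ideal I"
  shows "I \<subseteq> t_ideal I"
proof
  fix x assume "x \<in> I"
  then show "x \<in> t_ideal I"
    unfolding mem_t_ideal_iff[OF assms] by (cases "x = 0") (auto intro!: exI[of _ "{x}"])
qed

lemma t_ideal_mono:
  assumes "is_ideal I" "is_ideal J" "I \<subseteq> J"
  shows "t_ideal I \<subseteq> t_ideal J"
proof
  fix x assume x: "x \<in> t_ideal I"
  show "x \<in> t_ideal J"
  proof (cases "x = 0")
    case False
    then obtain S where "S \<subseteq> I" "finite S" "\<exists>s\<in>S. s \<noteq> 0"
        "\<And>u. (\<And>s. s \<in> S \<Longrightarrow> u * to_fract s \<in> range to_fract) \<Longrightarrow> u * to_fract x \<in> range to_fract"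
      using t_ideal_nonzeroE[OF assms(1) x] by metis
    then show ?thesis
      unfolding mem_t_ideal_iff[OF assms(2)] using assms(3) by (intro disjI2 exI[of _ S]) auto
  qed (simp add: mem_t_ideal_iff assms(2))
qed

text \<open>With finite witnesses \<open>S\<close> for \<open>x\<close> and \<open>U\<close> for
  \<open>y\<close>, the pairwise products are a witness for \<open>x * y\<close>: a multiplier
  \<open>u\<close> of these products is handled by first replacing \<open>S\<close> by
  \<open>x\<close>, then \<open>U\<close> by \<open>y\<close>.\<close>

lemma t_ideal_mult:
  assumes "is_ideal I" "is_ideal J" "is_ideal K" "\<And>a b. a \<in> I \<Longrightarrow> b \<in> J \<Longrightarrow> a * b \<in> K"
    and "x \<in> t_ideal I" "y \<in> t_ideal J"
  shows "x * y \<in> t_ideal K"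
proof (cases "x = 0 \<or> y = 0")
  case True
  then show ?thesis
    by (auto simp: mem_t_ideal_iff assms(3))
next
  case False
  obtain S where S: "S \<subseteq> I" "finite S" "\<exists>s\<in>S. s \<noteq> 0"
      "\<And>u. (\<And>s. s \<in> S \<Longrightarrow> u * to_fract s \<in> range to_fract) \<Longrightarrow> u * to_fract x \<in> range to_fract"
    using t_ideal_nonzeroE[OF assms(1,5)] False by metis
  obtain U where U: "U \<subseteq> J" "finite U" "\<exists>s\<in>U. s \<noteq> 0"
      "\<And>u. (\<And>s. s \<in> U \<Longrightarrow> u * to_fract s \<in> range to_fract) \<Longrightarrow> u * to_fract y \<in> range to_fract"
    using t_ideal_nonzeroE[OF assms(2,6)] False by metis
  define V where "V = (\<lambda>(a, b). a * b) ` (S \<times> U)"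
  have "u * to_fract (x * y) \<in> range to_fract" if u: "\<forall>s\<in>V. u * to_fract s \<in> range to_fract" for u
  proof -
    have "u * to_fract b * to_fract x \<in> range to_fract" if "b \<in> U" for b
    proof (rule S(4))
      fix a assume "a \<in> S"
      then have "u * to_fract (a * b) \<in> range to_fract"
        using u that by (auto simp: V_def simp del: to_fract_mult)
      then show "u * to_fract b * to_fract a \<in> range to_fract"
        by (simp add: mult_ac)
    qed
    then have "u * to_fract x * to_fract y \<in> range to_fract"
      by (intro U(4)) (simp add: mult_ac)
    then show ?thesis
      by (simp add: mult_ac)
  qed
  moreover have "V \<subseteq> K" "finite V"
    using S(1,2) U(1,2) assms(4) by (auto simp: V_def)
  moreover have "\<exists>s\<in>V. s \<noteq> 0"
    using S(3) U(3) by (auto simp: V_def)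
  ultimately show ?thesis
    unfolding mem_t_ideal_iff[OF assms(3)] by blast
qed

text \<open>Scalars are the case of \<open>t_ideal_mult\<close> where one factor is the whole ring;
  for sums, the union of two finite witnesses serves both summands.\<close>

lemma is_ideal_t_ideal:
  assumes "is_ideal I"
  shows "is_ideal (t_ideal I)"
proof (rule idealI)
  show "0 \<in> t_ideal I"
    by (simp add: mem_t_ideal_iff assms)
  show "c * x \<in> t_ideal I" if "x \<in> t_ideal I" for c x
    using t_ideal_mult[OF module.subspace_UNIV[OF module_ring] assms assms] that
      t_ideal_superset[OF module.subspace_UNIV[OF module_ring]] ideal_scale[OF assms] by blast
  fix x y assume xy: "x \<in> t_ideal I" "y \<in> t_ideal I"
  show "x + y \<in> t_ideal I"
  proof (cases "x = 0 \<or> y = 0")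
    case False
    obtain S where S: "S \<subseteq> I" "finite S" "\<exists>s\<in>S. s \<noteq> 0"
        "\<And>u. (\<And>s. s \<in> S \<Longrightarrow> u * to_fract s \<in> range to_fract) \<Longrightarrow> u * to_fract x \<in> range to_fract"
      using t_ideal_nonzeroE[OF assms xy(1)] False by metis
    obtain U where U: "U \<subseteq> I" "finite U" "\<exists>s\<in>U. s \<noteq> 0"
        "\<And>u. (\<And>s. s \<in> U \<Longrightarrow> u * to_fract s \<in> range to_fract) \<Longrightarrow> u * to_fract y \<in> range to_fract"
      using t_ideal_nonzeroE[OF assms xy(2)] False by metis
    have "u * to_fract (x + y) \<in> range to_fract"
      if u: "\<forall>s\<in>S \<union> U. u * to_fract s \<in> range to_fract" for u
    proof -
      obtain a b where "u * to_fract x = to_fract a" "u * to_fract y = to_fract b"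
        using u S(4)[of u] U(4)[of u] by blast
      then have "u * to_fract (x + y) = to_fract (a + b)"
        by (simp add: distrib_left)
      then show ?thesis by blast
    qed
    then show ?thesis
      unfolding mem_t_ideal_iff[OF assms] using S U by (intro disjI2 exI[of _ "S \<union> U"]) blast
  qed (use xy in auto)
qed

section \<open>Products and powers of ideals\<close>

lemma is_ideal_ideal_power: "is_ideal (ideal_power I n)"
  by (cases n) (simp_all add: ideal_mult_def is_ideal_span module.subspace_UNIV[OF module_ring])

lemma ideal_mult_mem: "a \<in> I \<Longrightarrow> b \<in> J \<Longrightarrow> a * b \<in> ideal_mult I J"
  unfolding ideal_mult_def by (rule ideal_span_base) blast

lemma ideal_mult_least:
  assumes "is_ideal K" "\<And>a b. a \<in> I \<Longrightarrow> b \<in> J \<Longrightarrow> a * b \<in> K"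
  shows "ideal_mult I J \<subseteq> K"
  unfolding ideal_mult_def using assms by (intro ideal_span_minimal) auto

lemma is_ideal_mult_vimage:
  assumes "is_ideal K"
  shows "is_ideal {a. a * b \<in> K}"
  by (rule idealI) (auto simp: distrib_right mult.assoc ideal_0 ideal_add ideal_scale assms)

lemma ideal_power_add:
  "a \<in> ideal_power I m \<Longrightarrow> b \<in> ideal_power I n \<Longrightarrow> a * b \<in> ideal_power I (m + n)"
proof (induction m arbitrary: a)
  case 0
  then show ?case by (simp add: ideal_scale[OF is_ideal_ideal_power])
next
  case (Suc m)
  \<comment> \<open>For fixed \<open>b\<close>, the right-hand side is an ideal, so only the
    generating products of the power must be checked.\<close>
  have "ideal_power I (Suc m) \<subseteq> {a. a * b \<in> ideal_power I (Suc m + n)}"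
    unfolding ideal_power.simps(2)[of I m]
    by (intro ideal_mult_least is_ideal_mult_vimage is_ideal_ideal_power)
      (auto simp: mult.assoc intro: ideal_mult_mem Suc)
  then show ?case using Suc.prems by blast
qed

lemma ideal_power_mono: "I \<subseteq> J \<Longrightarrow> ideal_power I n \<subseteq> ideal_power J n"
proof (induction n)
  case (Suc n)
  then show ?case
    unfolding ideal_power.simps ideal_mult_def[of I]
    by (intro ideal_span_minimal) (auto simp: ideal_mult_def is_ideal_span intro!: ideal_span_base)
qed simp

section \<open>Basic properties of the t-integral closure\<close>

lemma t_integral_closureI:
  assumes "n \<ge> 1" "\<And>i. i \<in> {1..n} \<Longrightarrow> a i \<in> t_ideal (ideal_power I i)"
    and "x ^ n + (\<Sum>i=1..n. a i * x ^ (n - i)) = 0"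
  shows "x \<in> t_integral_closure I"
  unfolding t_integral_closure_def t_integral_over_def mem_Collect_eq
  by (intro exI[of _ n] exI[of _ a] conjI ballI assms)

lemma t_integral_closureE:
  assumes "x \<in> t_integral_closure I"
  obtains n a where "n \<ge> 1" "\<forall>i\<in>{1..n}. a i \<in> t_ideal (ideal_power I i)"
    "x ^ n + (\<Sum>i=1..n. a i * x ^ (n - i)) = 0"
  using assms unfolding t_integral_closure_def t_integral_over_def mem_Collect_eq
  by (elim exE conjE) (rule that)

lemma t_integral_closure_mono:
  assumes "I \<subseteq> J"
  shows "t_integral_closure I \<subseteq> t_integral_closure J"
proof
  fix x assume "x \<in> t_integral_closure I"
  then obtain n a where n: "n \<ge> 1" and a: "\<forall>i\<in>{1..n}. a i \<in> t_ideal (ideal_power I i)"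
    "x ^ n + (\<Sum>i=1..n. a i * x ^ (n - i)) = 0"
    by (rule t_integral_closureE)
  show "x \<in> t_integral_closure J"
  proof (rule t_integral_closureI[OF n _ a(2)])
    show "a i \<in> t_ideal (ideal_power J i)" if "i \<in> {1..n}" for i
      using bspec[OF a(1) that]
        t_ideal_mono[OF is_ideal_ideal_power is_ideal_ideal_power ideal_power_mono[OF assms]] by blast
  qed
qed

lemma t_integral_closure_superset: "I \<subseteq> t_integral_closure I"
proof
  fix x assume "x \<in> I"
  \<comment> \<open>The first power is by definition the product of \<open>I\<close> with the whole
    ring, hence the factor 1.\<close>
  then have "x * 1 \<in> ideal_power I 1"
    unfolding One_nat_def ideal_power.simps by (intro ideal_mult_mem) auto
  then have "- x \<in> t_ideal (ideal_power I 1)"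
    using t_ideal_superset[OF is_ideal_ideal_power, of I 1]
      ideal_neg[OF is_ideal_t_ideal[OF is_ideal_ideal_power]] by (metis mult_1_right subsetD)
  \<comment> \<open>The equation of degree 1 is \<open>x + (- x) = 0\<close>.\<close>
  then show "x \<in> t_integral_closure I"
    by (intro t_integral_closureI[of 1 "\<lambda>_. - x"]) auto
qed

section \<open>The \<open>t\<close>-Rees algebra\<close>

definition t_rees :: "'a::idom set \<Rightarrow> 'a poly set" where
  "t_rees I = {f. \<forall>n. coeff f n \<in> t_ideal (ideal_power I n)}"

lemma unital_subring_t_rees: "unital_subring (t_rees I)"
proof
  note A = is_ideal_t_ideal[OF is_ideal_ideal_power, of I]
  have "1 \<in> t_ideal (ideal_power I 0)"
    using t_ideal_superset[OF is_ideal_ideal_power, of I 0] by auto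
  then show "1 \<in> t_rees I"
    by (auto simp: t_rees_def coeff_1 intro: ideal_0[OF A])
  show "f + g \<in> t_rees I" if "f \<in> t_rees I" "g \<in> t_rees I" for f g
    using that by (auto simp: t_rees_def intro: ideal_add[OF A])
  show "- f \<in> t_rees I" if "f \<in> t_rees I" for f
    using that by (auto simp: t_rees_def intro: ideal_neg[OF A])
  show "f * g \<in> t_rees I" if "f \<in> t_rees I" "g \<in> t_rees I" for f g
  proof -
    \<comment> \<open>Each summand of the convolution stays in degree \<open>n\<close>, because the
      t-closures of powers multiply along the grading.\<close>
    have "coeff f i * coeff g (n - i) \<in> t_ideal (ideal_power I n)" if "i \<le> n" for i n
    proof (rule t_ideal_mult[OF is_ideal_ideal_power is_ideal_ideal_power is_ideal_ideal_power])
      show "a * b \<in> ideal_power I n" if "a \<in> ideal_power I i" "b \<in> ideal_power I (n - i)" for a b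
        using ideal_power_add[OF that] \<open>i \<le> n\<close> by simp
    qed (use \<open>f \<in> _\<close> \<open>g \<in> _\<close> in \<open>auto simp: t_rees_def\<close>)
    then show ?thesis
      by (auto simp: t_rees_def coeff_mult intro!: module.subspace_sum[OF module_ring A])
  qed
qed

text \<open>Multiplying an equation for \<open>x\<close> by \<open>X^n\<close> makes it homogeneous,
  with coefficients \<open>a i\<close> times \<open>X^i\<close>; conversely, the degree
  \<open>n\<close> component of an equation for \<open>xX\<close> is an equation for
  \<open>x\<close>.\<close>

lemma mem_t_integral_closure_iff:
  "x \<in> t_integral_closure I \<longleftrightarrow> unital_subring.integral_over (t_rees I) (monom x 1)"
proof -
  interpret unital_subring "t_rees I"
    by (rule unital_subring_t_rees)
  show ?thesis
    unfolding integral_over_iff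
  proof
    assume "x \<in> t_integral_closure I"
    then obtain n a where a: "\<forall>i\<in>{1..n}. a i \<in> t_ideal (ideal_power I i)"
      "x ^ n + (\<Sum>i=1..n. a i * x ^ (n - i)) = 0"
      by (rule t_integral_closureE)
    have "(\<Sum>i=1..n. monom (a i) i * monom x 1 ^ (n - i)) = (\<Sum>i=1..n. monom (a i * x ^ (n - i)) n)"
      by (intro sum.cong) (auto simp: monom_power mult_monom)
    then have "monom x 1 ^ n + (\<Sum>i=1..n. monom (a i) i * monom x 1 ^ (n - i)) = 0"
      using a(2) by (simp add: monom_power monom_sum[symmetric] add_monom)
    moreover have "monom (a i) i \<in> t_rees I" if "i \<in> {1..n}" for i
      using bspec[OF a(1) that] ideal_0[OF is_ideal_t_ideal[OF is_ideal_ideal_power]]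
      by (auto simp: t_rees_def)
    ultimately show "\<exists>n c. (\<forall>i\<in>{1..n}. c i \<in> t_rees I) \<and>
        monom x 1 ^ n + (\<Sum>i=1..n. c i * monom x 1 ^ (n - i)) = 0"
      by (intro exI[of _ n] exI[of _ "\<lambda>i. monom (a i) i"]) auto
  next
    assume "\<exists>n c. (\<forall>i\<in>{1..n}. c i \<in> t_rees I) \<and>
        monom x 1 ^ n + (\<Sum>i=1..n. c i * monom x 1 ^ (n - i)) = 0"
    then obtain n c where c: "\<And>i. i \<in> {1..n} \<Longrightarrow> c i \<in> t_rees I"
      "monom x 1 ^ n + (\<Sum>i=1..n. c i * monom x 1 ^ (n - i)) = 0"
      by blast
    \<comment> \<open>The \<open>c i\<close> need not be homogeneous, but only their components of
      degree \<open>i\<close> contribute to degree \<open>n\<close>.\<close>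
    have "coeff (c i * monom x 1 ^ (n - i)) n = coeff (c i) i * x ^ (n - i)" if "i \<in> {1..n}" for i
      using that coeff_monom_mult[of "x ^ (n - i)" "n - i" "c i" n] by (simp add: monom_power mult.commute)
    then have "coeff (monom x 1 ^ n + (\<Sum>i=1..n. c i * monom x 1 ^ (n - i))) n =
        x ^ n + (\<Sum>i=1..n. coeff (c i) i * x ^ (n - i))"
      by (simp add: coeff_sum monom_power)
    then have "x ^ n + (\<Sum>i=1..n. coeff (c i) i * x ^ (n - i)) = 0"
      unfolding c(2) by simp
    \<comment> \<open>For \<open>n = 0\<close> the equation would be \<open>1 = 0\<close> in the
      polynomial ring.\<close>
    moreover have "n \<ge> 1"
      using c(2) by (cases n) auto
    ultimately show "x \<in> t_integral_closure I"
      using c(1) by (intro t_integral_closureI[of n "\<lambda>i. coeff (c i) i"]) (simp_all add: t_rees_def)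
  qed
qed

lemma is_ideal_t_integral_closure:
  assumes "is_ideal I"
  shows "is_ideal (t_integral_closure I)"
proof (rule idealI)
  show "0 \<in> t_integral_closure I"
    using t_integral_closure_superset ideal_0[OF assms] by blast
  show "x + y \<in> t_integral_closure I" if "x \<in> t_integral_closure I" "y \<in> t_integral_closure I" for x y
    \<comment> \<open>Integrality of \<open>xX\<close> and \<open>yX\<close> over the t-Rees algebra
      passes to their sum \<open>(x + y)X\<close>.\<close>
    using unital_subring.integral_over_add[OF unital_subring_t_rees, of I "monom x 1" "monom y 1"] that
    by (simp add: mem_t_integral_closure_iff add_monom)
  fix c x assume "x \<in> t_integral_closure I"
  then obtain n a where n: "n \<ge> 1" and a: "\<forall>i\<in>{1..n}. a i \<in> t_ideal (ideal_power I i)"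
    "x ^ n + (\<Sum>i=1..n. a i * x ^ (n - i)) = 0"
    by (rule t_integral_closureE)
  \<comment> \<open>Multiplying the equation for \<open>x\<close> by \<open>c ^ n\<close> gives one
    for \<open>c * x\<close> with coefficients \<open>c ^ i * a i\<close>.\<close>
  have "c ^ i * a i * (c * x) ^ (n - i) = c ^ n * (a i * x ^ (n - i))" if "i \<in> {1..n}" for i
  proof -
    have "c ^ n = c ^ i * c ^ (n - i)"
      using that by (simp flip: power_add)
    then show ?thesis
      by (simp add: power_mult_distrib mult_ac)
  qed
  then have "(\<Sum>i=1..n. c ^ i * a i * (c * x) ^ (n - i)) = c ^ n * (\<Sum>i=1..n. a i * x ^ (n - i))"
    unfolding sum_distrib_left by (rule sum.cong[OF refl])
  then have "(c * x) ^ n + (\<Sum>i=1..n. c ^ i * a i * (c * x) ^ (n - i)) =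
      c ^ n * (x ^ n + (\<Sum>i=1..n. a i * x ^ (n - i)))"
    by (simp only: distrib_left power_mult_distrib)
  then have "(c * x) ^ n + (\<Sum>i=1..n. c ^ i * a i * (c * x) ^ (n - i)) = 0"
    by (simp only: a(2) mult_zero_right)
  then show "c * x \<in> t_integral_closure I"
    by (intro t_integral_closureI[of n "\<lambda>i. c ^ i * a i"] n
        ideal_scale[OF is_ideal_t_ideal[OF is_ideal_ideal_power]] bspec[OF a(1)])
qed

section \<open>Homomorphisms\<close>

context ring_homomorphism
begin

lemma map_zero: "\<phi> 0 = 0"
  using map_add[of 0 0] by simp

lemma map_power: "\<phi> (x ^ n) = \<phi> x ^ n"
  by (induction n) (simp_all add: map_one map_mult)

lemma map_sum: "\<phi> (sum f A) = (\<Sum>x\<in>A. \<phi> (f x))"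
  by (induction A rule: infinite_finite_induct) (simp_all add: map_zero map_add)

lemma is_ideal_vimage: "is_ideal J \<Longrightarrow> is_ideal (\<phi> -` J)"
  by (rule idealI) (auto simp: map_zero map_add map_mult ideal_0 ideal_add ideal_scale)

lemma image_ideal_power:
  "\<phi> ` ideal_power I n \<subseteq> ideal_power (ideal_span (\<phi> ` I)) n"
proof (induction n)
  case (Suc n)
  \<comment> \<open>The preimage of an ideal is an ideal, so only generating products need to be
    mapped.\<close>
  have "ideal_power I (Suc n) \<subseteq> \<phi> -` ideal_power (ideal_span (\<phi> ` I)) (Suc n)"
    using Suc unfolding ideal_power.simps
    by (intro ideal_mult_least is_ideal_vimage)
      (auto simp: map_mult ideal_mult_def[of _ "ideal_power _ _"] is_ideal_span
        intro!: ideal_mult_mem[unfolded ideal_mult_def] ideal_span_base)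
  then show ?case by blast
qed simp

end

text \<open>Compatibility is applied to the power of \<open>I\<close> rather than to
  \<open>I\<close>, followed by the inclusion of \<phi>(I^n)T in (\<phi>(I)T)^n.\<close>

lemma t_compatible_t_ideal_ideal_power:
  assumes "ring_homomorphism \<phi>" "t_compatible \<phi>" "x \<in> t_ideal (ideal_power I n)"
  shows "\<phi> x \<in> t_ideal (ideal_power (ideal_span (\<phi> ` I)) n)"
proof -
  interpret ring_homomorphism \<phi> by fact
  note J = is_ideal_ideal_power[of "ideal_span (\<phi> ` I)" n]
  show ?thesis
  proof (cases "ideal_power I n = {0}")
    \<comment> \<open>Compatibility speaks of nonzero ideals only; a zero power has zero
      t-closure.\<close>
    case True
    then have "x = 0"
      using assms(3) by (simp add: t_ideal_def t_closure_def)
    then show ?thesis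
      using ideal_0[OF is_ideal_t_ideal[OF J]] by (simp add: map_zero)
  next
    case False
    have "\<phi> x \<in> ideal_span (\<phi> ` t_ideal (ideal_power I n))"
      using assms(3) by (intro ideal_span_base imageI)
    also have "\<dots> \<subseteq> t_ideal (ideal_span (\<phi> ` ideal_power I n))"
      using assms(2) False is_ideal_ideal_power by (auto simp: t_compatible_def)
    also have "\<dots> \<subseteq> t_ideal (ideal_power (ideal_span (\<phi> ` I)) n)"
      by (intro t_ideal_mono is_ideal_span J ideal_span_minimal image_ideal_power)
    finally show ?thesis .
  qed
qed

text \<open>Applying \<phi> to an equation for \<open>x\<close> gives one for
  \<open>\<phi> x\<close>, with coefficients in the right t-closures by the preceding lemma.\<close>

lemma t_compatible_t_integral_closure:
  assumes "ring_homomorphism \<phi>" "t_compatible \<phi>" "x \<in> t_integral_closure I"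
  shows "\<phi> x \<in> t_integral_closure (ideal_span (\<phi> ` I))"
proof -
  interpret ring_homomorphism \<phi> by fact
  obtain n a where n: "n \<ge> 1" and a: "\<forall>i\<in>{1..n}. a i \<in> t_ideal (ideal_power I i)"
    "x ^ n + (\<Sum>i=1..n. a i * x ^ (n - i)) = 0"
    using assms(3) by (rule t_integral_closureE)
  have "\<phi> x ^ n + (\<Sum>i=1..n. \<phi> (a i) * \<phi> x ^ (n - i)) = 0"
    using arg_cong[OF a(2), of \<phi>] by (simp add: map_add map_sum map_mult map_power map_zero)
  then show ?thesis
    by (intro t_integral_closureI[of n "\<lambda>i. \<phi> (a i)"] n
        t_compatible_t_ideal_ideal_power[OF assms(1,2)] bspec[OF a(1)])
qed

theorem proposition4p3:
  fixes \<phi> :: "'a::idom \<Rightarrow> 'b::idom"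
    and I :: "'a set"
    and J :: "'b set"
  assumes "ring_homomorphism \<phi>"
    and "t_compatible \<phi>"
    and "is_ideal I"
    and "is_ideal J"
  shows "ideal_span (\<phi> ` t_integral_closure I) \<subseteq> t_integral_closure (ideal_span (\<phi> ` I)) \<and>
    t_integral_closure (\<phi> -` J) \<subseteq> \<phi> -` t_integral_closure J \<and>
    (t_integrally_closed J \<longrightarrow> t_integral_closure (\<phi> -` J) = \<phi> -` J)"
proof (intro conjI impI)
  note image = t_compatible_t_integral_closure[OF assms(1,2)]
  show "ideal_span (\<phi> ` t_integral_closure I) \<subseteq> t_integral_closure (ideal_span (\<phi> ` I))"
    \<comment> \<open>The images of single elements lie in the closure on the right; since that
      closure is an ideal, it contains the ideal they generate.\<close>
    using image by (intro ideal_span_minimal is_ideal_t_integral_closure is_ideal_span) blast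
  have "ideal_span (\<phi> ` (\<phi> -` J)) \<subseteq> J"
    by (intro ideal_span_minimal assms(4)) blast
  then show preimage: "t_integral_closure (\<phi> -` J) \<subseteq> \<phi> -` t_integral_closure J"
    using image t_integral_closure_mono by blast
  assume "t_integrally_closed J"
  then show "t_integral_closure (\<phi> -` J) = \<phi> -` J"
    using preimage t_integral_closure_superset[of "\<phi> -` J"]
    by (simp add: t_integrally_closed_def subset_antisym)
qed

end
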